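(* There exists a polycyclic metabelian group $G$ with trivial pseudocentre, $P(G)=\{1\}$. Furthermore, this group is residually pseudonilpotent of class at most $2$, that is, the intersection of all normal subgroups $N$ of $G$ such that $G/N$ is pseudonilpotent of class at most $2$ is trivial.
   Context: For a group $G$, the pseudocentre is $P(G)=\bigcap_{x\in G}C_G(x)^G$, where $C_G(x)$ is the centralizer of $x$ in $G$ and, for a subgroup $H\leq G$, $H^G$ is the normal closure of $H$ in $G$. Put $P_1(G)=P(G)$ and define $P_2(G)$ by $P_2(G)/P_1(G)=P\big(G/P_1(G)\big)$; a group $G$ is pseudonilpotent of class at most $2$ if $P_2(G)=G$. A group is polycyclic if it is soluble and satisfies the maximal condition on subgroups; it is metabelian if $G'$ is abelian. *)

theory Defs
  imports "HOL-Algebra.Algebra"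
begin

definition centralizer :: "('a, 'b) monoid_scheme \<Rightarrow> 'a \<Rightarrow> 'a set" where
  "centralizer G x = {g \<in> carrier G. g \<otimes>\<^bsub>G\<^esub> x = x \<otimes>\<^bsub>G\<^esub> g}"

definition normal_closure :: "('a, 'b) monoid_scheme \<Rightarrow> 'a set \<Rightarrow> 'a set" where
  "normal_closure G H = \<Inter> {N. N \<lhd> G \<and> H \<subseteq> N}"

definition pseudocentre :: "('a, 'b) monoid_scheme \<Rightarrow> 'a set" where
  "pseudocentre G = (\<Inter>x\<in>carrier G. normal_closure G (centralizer G x))"

(* The preimage in G of P(G / P(G)). *)
definition second_pseudocentre :: "('a, 'b) monoid_scheme \<Rightarrow> 'a set" where
  "second_pseudocentre G =
     {g \<in> carrier G. pseudocentre G #>\<^bsub>G\<^esub> g \<in> pseudocentre (G Mod pseudocentre G)}"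

definition pseudonilpotent_class_le_2 :: "('a, 'b) monoid_scheme \<Rightarrow> bool" where
  "pseudonilpotent_class_le_2 G \<longleftrightarrow> group G \<and> second_pseudocentre G = carrier G"

definition residually_pseudonilpotent_class_le_2 :: "('a, 'b) monoid_scheme \<Rightarrow> bool" where
  "residually_pseudonilpotent_class_le_2 G \<longleftrightarrow>
     group G \<and> \<Inter> {N. N \<lhd> G \<and> pseudonilpotent_class_le_2 (G Mod N)} = {\<one>\<^bsub>G\<^esub>}"

definition max_condition_on_subgroups :: "('a, 'b) monoid_scheme \<Rightarrow> bool" where
  "max_condition_on_subgroups G \<longleftrightarrow>
     (\<forall>\<S>. \<S> \<noteq> {} \<and> (\<forall>H\<in>\<S>. subgroup H G)
        \<longrightarrow> (\<exists>M\<in>\<S>. \<forall>H\<in>\<S>. M \<subseteq> H \<longrightarrow> H = M))"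

definition polycyclic_group :: "('a, 'b) monoid_scheme \<Rightarrow> bool" where
  "polycyclic_group G \<longleftrightarrow> group G \<and> solvable G \<and> max_condition_on_subgroups G"

definition metabelian_group :: "('a, 'b) monoid_scheme \<Rightarrow> bool" where
  "metabelian_group G \<longleftrightarrow>
     group G \<and> comm_group (G\<lparr>carrier := derived G (carrier G)\<rparr>)"

end

theory Submission
  imports Defs
begin

text \<open>
  Let \<open>w = 3 + 2 sqrt 2\<close>, a unit of norm 1 in \<open>R = \<int>[sqrt 2]\<close>, and let \<open>G\<close> be the semidirect product of
  \<open>R\<close> and \<open>\<int>\<close>, where \<open>k\<close> acts as multiplication by \<open>w ^ (2 * k)\<close>. Writing \<open>w ^ k = a + b sqrt 2\<close>, one has
  \<open>w ^ (2 * k) - 1 = 2 b sqrt 2 w ^ k\<close> and \<open>w ^ (2 * k) + 1 = 2 a w ^ k\<close>, so up to units the elements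
  that matter are integer multiples of \<open>sqrt 2\<close> or integers.

  For the trivial pseudocentre, consider the element \<open>(2 ^ n, 2 ^ (n + 1))\<close>. Its centralizer is contained in
  the normal subgroup of all \<open>(z, k)\<close> with \<open>2 ^ n\<close> dividing \<open>z\<close> and \<open>2 ^ (n + 1)\<close> dividing \<open>k\<close>,
  and these subgroups intersect trivially.

  For an odd prime \<open>q\<close>, the first identity shows that \<open>w ^ (2 * k) - 1\<close> is either zero or invertible modulo \<open>q\<close>.
  Hence in \<open>G / qR\<close> every element either commutes with \<open>R / qR\<close> or has all of \<open>R / qR\<close> among its
  commutators with it, so the pseudocentre of \<open>G / qR\<close> contains \<open>R / qR\<close> and the quotient by it is abelian.
\<close>

section \<open>The ring of integers with a square root of 2\<close>

datatype zsqrt2 = ZSqrt2 (ipart: int) (rpart: int)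

lemma zsqrt2_eq_iff: "x = y \<longleftrightarrow> ipart x = ipart y \<and> rpart x = rpart y"
  by (cases x; cases y) simp

instantiation zsqrt2 :: comm_ring_1
begin

definition "0 = ZSqrt2 0 0"
definition "1 = ZSqrt2 1 0"
definition "x + y = ZSqrt2 (ipart x + ipart y) (rpart x + rpart y)"
definition "x - y = ZSqrt2 (ipart x - ipart y) (rpart x - rpart y)"
definition "- x = ZSqrt2 (- ipart x) (- rpart x)"
definition "x * y = ZSqrt2 (ipart x * ipart y + 2 * rpart x * rpart y)
                           (ipart x * rpart y + rpart x * ipart y)"

instance
  by standard
    (simp_all add: zero_zsqrt2_def one_zsqrt2_def plus_zsqrt2_def minus_zsqrt2_def
      uminus_zsqrt2_def times_zsqrt2_def algebra_simps)

end

lemma zsqrt2_parts [simp]: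
  "ipart 0 = 0" "rpart 0 = 0" "ipart 1 = 1" "rpart 1 = 0"
  "ipart (x + y) = ipart x + ipart y" "rpart (x + y) = rpart x + rpart y"
  "ipart (x - y) = ipart x - ipart y" "rpart (x - y) = rpart x - rpart y"
  "ipart (- x) = - ipart x" "rpart (- x) = - rpart x"
  "ipart (x * y) = ipart x * ipart y + 2 * rpart x * rpart y"
  "rpart (x * y) = ipart x * rpart y + rpart x * ipart y"
  by (simp_all add: zero_zsqrt2_def one_zsqrt2_def plus_zsqrt2_def minus_zsqrt2_def
      uminus_zsqrt2_def times_zsqrt2_def)

lemma zsqrt2_of_nat_parts [simp]: "ipart (of_nat n) = int n" "rpart (of_nat n) = 0"
  by (induction n) simp_all

lemma zsqrt2_of_int_parts [simp]: "ipart (of_int n) = n" "rpart (of_int n) = 0"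
  by (cases n; simp)+

lemma zsqrt2_numeral_parts [simp]:
  "ipart (numeral n) = numeral n" "rpart (numeral n) = 0"
  using zsqrt2_of_int_parts[of "numeral n"] by simp_all

text \<open>An integer multiplies both coordinates, so its divisibility relations in R reduce to
  ones between integers.\<close>

lemma of_int_dvd_zsqrt2_iff:
  "of_int c dvd (z :: zsqrt2) \<longleftrightarrow> c dvd ipart z \<and> c dvd rpart z"
proof
  assume "c dvd ipart z \<and> c dvd rpart z"
  then obtain a b where "ipart z = c * a" "rpart z = c * b"
    by (auto elim!: dvdE)
  then have "z = of_int c * ZSqrt2 a b"
    by (simp add: zsqrt2_eq_iff)
  then show "of_int c dvd z" by simp
qed auto

lemma of_int_dvd_cancel_coprime:
  assumes "coprime c d" "of_int c dvd (of_int d * z :: zsqrt2)"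
  shows "of_int c dvd z"
  using assms by (auto simp: of_int_dvd_zsqrt2_iff coprime_dvd_mult_right_iff)

text \<open>A nonzero integer has no divisor beyond its absolute value. Both intersections of
  subgroups below are shown to be trivial this way.\<close>

lemma zsqrt2_eq_0_if_dvd_large:
  assumes "\<And>b. \<exists>c>b. of_int c dvd (z :: zsqrt2)"
  shows "z = 0"
proof -
  obtain c where "c > max \<bar>ipart z\<bar> \<bar>rpart z\<bar>" "of_int c dvd z"
    using assms by blast
  then have "ipart z = 0" "rpart z = 0"
    using dvd_imp_le_int[of "ipart z" c] dvd_imp_le_int[of "rpart z" c]
    by (force simp: of_int_dvd_zsqrt2_iff)+
  then show ?thesis by (simp add: zsqrt2_eq_iff)
qed

section \<open>Powers of the unit 3 + 2 sqrt 2\<close>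

text \<open>This is \<open>w ^ k\<close> for every integer \<open>k\<close>: since w has norm 1, its
  inverse is the conjugate 3 - 2 sqrt 2.\<close>

definition unit_pow :: "int \<Rightarrow> zsqrt2" where
  "unit_pow k = (if 0 \<le> k then ZSqrt2 3 2 ^ nat k else ZSqrt2 3 (- 2) ^ nat (- k))"

lemma unit_pow_0 [simp]: "unit_pow 0 = 1"
  by (simp add: unit_pow_def)

lemma unit_pow_1: "unit_pow 1 = ZSqrt2 3 2"
  by (simp add: unit_pow_def)

lemma unit_pow_Suc: "unit_pow (k + 1) = ZSqrt2 3 2 * unit_pow k"
proof (cases "0 \<le> k")
  case True
  then show ?thesis by (simp add: unit_pow_def nat_add_distrib)
next
  case False
  have inv: "ZSqrt2 3 2 * ZSqrt2 3 (- 2) = 1"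
    by (simp add: zsqrt2_eq_iff)
  have "nat (- k) = Suc (nat (- (k + 1)))"
    using False by simp
  then have "unit_pow k = ZSqrt2 3 (- 2) * unit_pow (k + 1)"
    using False by (auto simp: unit_pow_def)
  then show ?thesis
    by (simp add: inv mult.assoc[symmetric])
qed

lemma unit_pow_add: "unit_pow (k + l) = unit_pow k * unit_pow l"
proof (induction k rule: int_induct[where k = 0])
  case (step1 i)
  then show ?case
    using unit_pow_Suc[of "i + l"] unit_pow_Suc[of i] by (simp add: ac_simps)
next
  case (step2 i)
  have inv: "ZSqrt2 3 (- 2) * (ZSqrt2 3 2 * x) = x" for x
    by (simp add: zsqrt2_eq_iff)
  have "ZSqrt2 3 2 * unit_pow (i - 1 + l) = ZSqrt2 3 2 * (unit_pow (i - 1) * unit_pow l)"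
    using step2 unit_pow_Suc[of "i - 1 + l"] unit_pow_Suc[of "i - 1"]
    by (simp add: algebra_simps)
  then show ?case
    by (metis inv)
qed simp

text \<open>Conjugation respects products and sends w to its inverse.\<close>

lemma unit_pow_minus:
  "unit_pow (- k) = ZSqrt2 (ipart (unit_pow k)) (- rpart (unit_pow k))"
proof -
  have conj_pow: "ZSqrt2 a (- b) ^ n = ZSqrt2 (ipart (ZSqrt2 a b ^ n)) (- rpart (ZSqrt2 a b ^ n))"
    for a b n
    by (induction n) (simp_all add: zsqrt2_eq_iff)
  show ?thesis
    using conj_pow[of 3 2 "nat k"] conj_pow[of 3 2 "nat (- k)"]
    by (auto simp: unit_pow_def)
qed

lemma unit_pow_minus_mult [simp]: "unit_pow (- k) * unit_pow k = 1"
  using unit_pow_add[of "- k" k] by simp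

text \<open>The Pell equation, read off from the first coordinate of
  \<open>unit_pow (- k) * unit_pow k = 1\<close>.\<close>

lemma unit_pow_norm: "ipart (unit_pow k) ^ 2 = 1 + 2 * rpart (unit_pow k) ^ 2"
proof -
  have "ipart (unit_pow (- k) * unit_pow k) = 1" by simp
  then show ?thesis
    by (simp only: unit_pow_minus zsqrt2_parts) (simp add: power2_eq_square)
qed

section \<open>The action of the integers on R\<close>

text \<open>The doubled exponent makes \<open>act k - 1\<close> and \<open>act k + 1\<close> factor
  as \<open>unit_pow k\<close> times the difference or sum of \<open>unit_pow k\<close> and its
  conjugate.\<close>

definition act :: "int \<Rightarrow> zsqrt2" where
  "act k = unit_pow (2 * k)"

lemma act_0 [simp]: "act 0 = 1"
  by (simp add: act_def)

lemma act_add: "act (k + l) = act k * act l"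
  by (simp add: act_def distrib_left unit_pow_add)

lemma act_minus_mult [simp]: "act (- k) * act k = 1"
  using act_add[of "- k" k] by simp

lemma act_mult_minus [simp]: "act k * act (- k) = 1"
  using act_minus_mult[of k] by (simp only: mult.commute)

lemma act_minus_1:
  "act k - 1 = unit_pow k * (of_int (2 * rpart (unit_pow k)) * ZSqrt2 0 1)"
proof -
  have "act k - 1 = unit_pow k * (unit_pow k - unit_pow (- k))"
    using unit_pow_add[of k k] unit_pow_minus_mult[of k]
    by (simp add: act_def algebra_simps mult_2)
  also have "unit_pow k - unit_pow (- k) = of_int (2 * rpart (unit_pow k)) * ZSqrt2 0 1"
    by (simp add: unit_pow_minus zsqrt2_eq_iff)
  finally show ?thesis .
qed

lemma act_plus_1: "act k + 1 = unit_pow k * of_int (2 * ipart (unit_pow k))"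
proof -
  have "act k + 1 = unit_pow k * (unit_pow k + unit_pow (- k))"
    using unit_pow_add[of k k] unit_pow_minus_mult[of k]
    by (simp add: act_def algebra_simps mult_2)
  also have "unit_pow k + unit_pow (- k) = of_int (2 * ipart (unit_pow k))"
    by (simp add: unit_pow_minus zsqrt2_eq_iff)
  finally show ?thesis .
qed

text \<open>With the next lemmas: the integers acting trivially modulo \<open>d\<close> form a
  subgroup, hence one closed under gcd.\<close>

lemma dvd_act_minus_1_add:
  assumes "d dvd act k - 1" "d dvd act l - 1"
  shows "d dvd act (k + l) - 1"
proof -
  have "act (k + l) - 1 = act l * (act k - 1) + (act l - 1)"
    by (simp add: act_add algebra_simps)
  then show ?thesis using assms by (metis dvd_add dvd_mult)
qed

lemma dvd_act_minus_1_minus: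
  assumes "d dvd act k - 1"
  shows "d dvd act (- k) - 1"
proof -
  have "act (- k) - 1 = (- act (- k)) * (act k - 1)"
    by (simp add: algebra_simps)
  then show ?thesis using assms by (metis dvd_mult)
qed

lemma dvd_act_minus_1_mult:
  assumes "d dvd act k - 1"
  shows "d dvd act (l * k) - 1"
proof (induction l rule: int_induct[where k = 0])
  case (step1 i)
  then show ?case
    using dvd_act_minus_1_add[OF step1.IH assms] by (simp add: algebra_simps)
next
  case (step2 i)
  then show ?case
    using dvd_act_minus_1_add[OF step2.IH dvd_act_minus_1_minus[OF assms]]
    by (simp add: algebra_simps)
qed simp

lemma dvd_act_minus_1_gcd:
  assumes "d dvd act k - 1" "d dvd act l - 1"
  shows "d dvd act (gcd k l) - 1"
proof -
  obtain p q where "p * k + q * l = gcd k l"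
    using bezout_int by blast
  then show ?thesis
    using dvd_act_minus_1_add[OF dvd_act_minus_1_mult[OF assms(1), of p]
        dvd_act_minus_1_mult[OF assms(2), of q]] by simp
qed

lemma unit_pow_double_parts:
  "ipart (unit_pow (2 * k)) = 2 * ipart (unit_pow k) ^ 2 - 1"
  "rpart (unit_pow (2 * k)) = 2 * ipart (unit_pow k) * rpart (unit_pow k)"
proof -
  have double: "unit_pow (2 * k) = unit_pow k * unit_pow k"
    using unit_pow_add[of k k] by (simp only: mult_2)
  show "ipart (unit_pow (2 * k)) = 2 * ipart (unit_pow k) ^ 2 - 1"
    unfolding double zsqrt2_parts using unit_pow_norm[of k]
    by (simp add: power2_eq_square mult.assoc)
  show "rpart (unit_pow (2 * k)) = 2 * ipart (unit_pow k) * rpart (unit_pow k)"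
    unfolding double zsqrt2_parts by simp
qed

text \<open>Doubling the exponent replaces (a, b) by (2 a^2 - 1, 2 a b): a stays odd and at least 3,
  while b gains a factor 2.\<close>

lemma unit_pow_two_power:
  "odd (ipart (unit_pow (2 ^ n))) \<and> ipart (unit_pow (2 ^ n)) \<ge> 3 \<and>
   rpart (unit_pow (2 ^ n)) \<noteq> 0 \<and> 2 ^ n dvd rpart (unit_pow (2 ^ n))"
proof (induction n)
  case 0
  then show ?case by (simp add: unit_pow_1)
next
  case (Suc n)
  have "ipart (unit_pow (2 ^ n)) ^ 2 \<ge> 3 ^ 2"
    using Suc by (intro power_mono) auto
  then show ?case
    using Suc by (auto simp: unit_pow_double_parts)
qed

lemma act_two_power_minus_1_dvd: "2 ^ n dvd act (2 ^ n) - 1"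
proof -
  have "of_int (2 ^ n) dvd act (2 ^ n) - 1"
    unfolding act_minus_1
    by (intro dvd_mult[OF dvd_mult2])
      (simp add: of_int_dvd_zsqrt2_iff unit_pow_two_power del: of_int_mult of_int_power)
  then show ?thesis by simp
qed

text \<open>\<open>act k - 1\<close> is a unit times a nonzero integer times sqrt 2, and
  multiplication by each factor is injective.\<close>

lemma act_minus_1_cancel:
  assumes "z * (act k - 1) = 0" "rpart (unit_pow k) \<noteq> 0"
  shows "z = 0"
proof -
  have "(unit_pow (- k) * unit_pow k) * (of_int (2 * rpart (unit_pow k)) * ZSqrt2 0 1) * z = 0"
    using assms(1) unfolding act_minus_1 by (metis mult.assoc mult.commute mult_zero_left)
  then show ?thesis
    using assms(2) by (simp add: zsqrt2_eq_iff)
qed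

text \<open>
  The odd number \<open>a = ipart (unit_pow (2 ^ n)) > 1\<close> divides \<open>act (2 ^ n) + 1\<close>, so modulo \<open>a\<close> the
  action of \<open>2 ^ n\<close> is \<open>-1\<close> and the integers acting trivially are multiples of \<open>2 ^ (n + 1)\<close>.
\<close>
lemma centralizer_equation:
  assumes eq: "y * (act (2 ^ Suc n) - 1) = 2 ^ n * (act m - 1)"
  shows "2 ^ Suc n dvd m \<and> 2 ^ n dvd y"
proof -
  define a where "a = ipart (unit_pow (2 ^ n))"
  have a: "odd a" "a \<ge> 3"
    using unit_pow_two_power[of n] by (auto simp: a_def)
  have a_plus: "of_int a dvd act (2 ^ n) + 1"
    unfolding act_plus_1 a_def by (intro dvd_mult) (simp add: of_int_dvd_zsqrt2_iff)
  have "act (2 ^ Suc n) = act (2 ^ n) * act (2 ^ n)"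
    using act_add[of "2 ^ n" "2 ^ n"] by (simp only: mult_2 power_Suc)
  then have "act (2 ^ Suc n) - 1 = (act (2 ^ n) - 1) * (act (2 ^ n) + 1)"
    by (simp only: distrib_left left_diff_distrib) simp
  then have a_Suc: "of_int a dvd act (2 ^ Suc n) - 1"
    using a_plus by simp
  have a_mult: "of_int a dvd of_int (2 ^ n) * (act m - 1)"
    using a_Suc eq by (metis dvd_mult of_int_numeral of_int_power)
  have "coprime a (2 ^ n)"
    using a by simp
  then have a_m: "of_int a dvd act m - 1"
    using a_mult by (rule of_int_dvd_cancel_coprime)
  \<comment> \<open>Modulo \<open>a\<close>, both \<open>2 ^ Suc n\<close> and \<open>m\<close> act
    trivially, hence so does their gcd. If the gcd is not \<open>2 ^ Suc n\<close>, it divides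
    \<open>2 ^ n\<close>, which then acts both as 1 and as -1, forcing \<open>a\<close> to divide
    2.\<close>
  have m: "2 ^ Suc n dvd m"
  proof (rule ccontr)
    assume not: "\<not> 2 ^ Suc n dvd m"
    have "gcd (2 ^ Suc n) m dvd 2 ^ Suc n" by simp
    then obtain i where i: "i \<le> Suc n" "gcd (2 ^ Suc n) m = 2 ^ i"
      using divides_primepow[of 2 "gcd (2 ^ Suc n) m" "Suc n"] by auto
    have "i \<noteq> Suc n"
      using i not by (metis gcd_dvd2)
    then have "(2::int) ^ i dvd 2 ^ n"
      using i by (intro le_imp_power_dvd) simp
    then obtain l where "2 ^ n = l * (2::int) ^ i"
      by (metis dvdE mult.commute)
    then have "of_int a dvd act (2 ^ n) - 1"
      using dvd_act_minus_1_mult[OF dvd_act_minus_1_gcd[OF a_Suc a_m], of l] i by simp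
    then have "of_int a dvd (act (2 ^ n) + 1) - (act (2 ^ n) - 1)"
      using a_plus dvd_diff by blast
    then have "of_int a dvd (of_int 2 :: zsqrt2)"
      by simp
    then have "a dvd 2"
      by (simp only: of_int_dvd_zsqrt2_iff zsqrt2_of_int_parts)
    then show False
      using a zdvd_imp_le[of a 2] by simp
  qed
  \<comment> \<open>Now \<open>act (2 ^ Suc n) - 1\<close> divides \<open>act m - 1\<close>;
    cancelling it from \<open>eq\<close> leaves \<open>y = 2 ^ n * r\<close>.\<close>
  then obtain l where "m = l * 2 ^ Suc n"
    by (metis dvdE mult.commute)
  then obtain r where "act m - 1 = (act (2 ^ Suc n) - 1) * r"
    using dvd_act_minus_1_mult[of "act (2 ^ Suc n) - 1" "2 ^ Suc n" l] by (auto elim: dvdE)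
  then have "(y - 2 ^ n * r) * (act (2 ^ Suc n) - 1) = 0"
    using eq by (simp only: left_diff_distrib mult.assoc mult.commute[of r] diff_self)
  then have "y - 2 ^ n * r = 0"
    using act_minus_1_cancel unit_pow_two_power[of "Suc n"] by blast
  then show ?thesis using m by simp
qed

text \<open>R / qR need not be a field, but 2 and sqrt 2 are units in it. So
  \<open>act k - 1\<close> is a unit times the integer \<open>rpart (unit_pow k)\<close>, which is
  zero or invertible modulo the prime \<open>q\<close>.\<close>

lemma act_minus_1_prime_cases:
  fixes q :: int
  assumes "Factorial_Ring.prime q" "odd q"
  obtains "of_int q dvd act k - 1" | c where "of_int q dvd c * (act k - 1) - 1"
proof (cases "q dvd rpart (unit_pow k)")
  case True
  then have "of_int q dvd (of_int (2 * rpart (unit_pow k)) :: zsqrt2)"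
    by (simp add: of_int_dvd_zsqrt2_iff)
  then have "of_int q dvd act k - 1"
    unfolding act_minus_1 by (intro dvd_mult[OF dvd_mult2])
  then show ?thesis by fact
next
  case False
  define b where "b = rpart (unit_pow k)"
  have "coprime q (4 * b)"
    using False assms prime_imp_coprime[OF \<open>Factorial_Ring.prime q\<close>, of b]
    by (simp add: b_def) (metis coprime_left_2_iff_odd coprime_commute coprime_mult_right_iff mult_2_right numeral_Bit0)
  then obtain e f where ef: "e * q + f * (4 * b) = 1"
    using bezout_int[of q "4 * b"] by (metis coprime_iff_gcd_eq_1)
  \<comment> \<open>\<open>f\<close> inverts \<open>4 * b\<close> modulo \<open>q\<close>, the
    factor \<open>unit_pow (- k)\<close> removes the unit, and the second sqrt 2 turns 2 b sqrt 2
    into 4 b.\<close>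
  define c where "c = unit_pow (- k) * (of_int f * ZSqrt2 0 1)"
  have "c * (act k - 1) =
      (unit_pow (- k) * unit_pow k) * ((of_int f * ZSqrt2 0 1) * (of_int (2 * b) * ZSqrt2 0 1))"
    unfolding act_minus_1 c_def b_def by (simp only: ac_simps)
  then have "c * (act k - 1) - 1 = of_int (f * (4 * b) - 1)"
    by (simp add: zsqrt2_eq_iff)
  also have "f * (4 * b) - 1 = q * (- e)"
    using ef by (simp add: algebra_simps)
  finally have "of_int q dvd c * (act k - 1) - 1"
    by simp
  then show ?thesis by fact
qed


section \<open>Pseudocentres\<close>

text \<open>For an upper bound one normal subgroup above one centralizer suffices; a lower bound
  considers an arbitrary such pair.\<close>

lemma mem_pseudocentre_iff:
  "g \<in> pseudocentre G \<longleftrightarrow>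
    (\<forall>x\<in>carrier G. \<forall>N. N \<lhd> G \<longrightarrow> centralizer G x \<subseteq> N \<longrightarrow> g \<in> N)"
  by (auto simp: pseudocentre_def normal_closure_def)

context group
begin

lemma normal_Inter:
  assumes "\<And>N. N \<in> A \<Longrightarrow> N \<lhd> G" "A \<noteq> {}"
  shows "\<Inter>A \<lhd> G"
  using assms subgroups_Inter[of A] unfolding normal_inv_iff by auto

lemma pseudocentre_normal: "pseudocentre G \<lhd> G"
proof -
  \<comment> \<open>The whole group belongs to each family, so no intersection is
    empty-indexed.\<close>
  have "carrier G \<lhd> G"
    by (simp add: normal_inv_iff subgroup_self)
  then have "normal_closure G (centralizer G x) \<lhd> G" for x
    unfolding normal_closure_def by (intro normal_Inter) (auto simp: centralizer_def)
  then show ?thesis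
    unfolding pseudocentre_def using one_closed by (intro normal_Inter) auto
qed

lemma one_mem_pseudocentre: "\<one> \<in> pseudocentre G"
  using pseudocentre_normal normal_inv_iff subgroup.one_closed by blast

lemma comm_group_Mod_if_commutators:
  assumes "N \<lhd> G"
    and comm: "\<And>x y. x \<in> carrier G \<Longrightarrow> y \<in> carrier G \<Longrightarrow> x \<otimes> y \<otimes> inv x \<otimes> inv y \<in> N"
  shows "comm_group (G Mod N)"
proof (rule group.group_comm_groupI)
  interpret N: normal N G by fact
  show "group (G Mod N)" by (rule N.factorgroup_is_group)
  fix S T assume "S \<in> carrier (G Mod N)" "T \<in> carrier (G Mod N)"
  then obtain x y where xy: "x \<in> carrier G" "S = N #> x" "y \<in> carrier G" "T = N #> y"
    by (auto simp: FactGroup_def RCOSETS_def)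
  have "x \<otimes> y \<in> N #> (y \<otimes> x)"
    using xy comm by (simp add: N.rcos_module is_group inv_mult_group m_assoc)
  then have "N #> (y \<otimes> x) = N #> (x \<otimes> y)"
    using xy by (intro repr_independence N.is_subgroup) auto
  then show "S \<otimes>\<^bsub>G Mod N\<^esub> T = T \<otimes>\<^bsub>G Mod N\<^esub> S"
    using xy by (simp add: FactGroup_def N.rcos_sum)
qed

end

lemma (in comm_group) pseudocentre_eq_carrier: "pseudocentre G = carrier G"
proof -
  have "centralizer G x = carrier G" if "x \<in> carrier G" for x
    using that m_comm by (auto simp: centralizer_def)
  moreover have "pseudocentre G \<subseteq> carrier G"
    using pseudocentre_normal normal_inv_iff subgroup.subset by blast
  ultimately show ?thesis
    by (auto simp: mem_pseudocentre_iff)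
qed

text \<open>The quotient by the pseudocentre is then abelian, so it is its own pseudocentre.\<close>

lemma (in group) pseudonilpotent_class_le_2_if_commutators:
  assumes "\<And>x y. x \<in> carrier G \<Longrightarrow> y \<in> carrier G \<Longrightarrow> x \<otimes> y \<otimes> inv x \<otimes> inv y \<in> pseudocentre G"
  shows "pseudonilpotent_class_le_2 G"
proof -
  interpret Q: comm_group "G Mod pseudocentre G"
    using assms by (intro comm_group_Mod_if_commutators pseudocentre_normal)
  show ?thesis
    by (auto simp: pseudonilpotent_class_le_2_def second_pseudocentre_def is_group
        Q.pseudocentre_eq_carrier) (auto simp: FactGroup_def RCOSETS_def)
qed

lemma (in group) metabelian_imp_solvable:
  assumes "metabelian_group G"
  shows "solvable G"
proof -
  let ?D = "derived G (carrier G)"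
  have "subgroup ?D G"
    by (rule derived_is_subgroup) simp
  moreover have "derived (G\<lparr>carrier := ?D\<rparr>) ?D = {\<one>}"
    using comm_group.derived_eq_singleton[of "G\<lparr>carrier := ?D\<rparr>" ?D] assms
    by (simp add: metabelian_group_def)
  ultimately have "(derived G ^^ 2) (carrier G) = {\<one>}"
    by (simp add: derived_consistent numeral_2_eq_2)
  then show ?thesis
    using solvable_iff_trivial_derived_seq by blast
qed

section \<open>The maximal condition\<close>

text \<open>Relative to a subset of a fixed group, so that passing to successive kernels never
  changes the group.\<close>

definition max_condition_below :: "('a, 'b) monoid_scheme \<Rightarrow> 'a set \<Rightarrow> bool" where
  "max_condition_below G K \<longleftrightarrow>
     (\<forall>\<S>. \<S> \<noteq> {} \<and> (\<forall>H\<in>\<S>. subgroup H G \<and> H \<subseteq> K)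
        \<longrightarrow> (\<exists>M\<in>\<S>. \<forall>H\<in>\<S>. M \<subseteq> H \<longrightarrow> H = M))"

lemma max_condition_on_subgroups_iff:
  "max_condition_on_subgroups G \<longleftrightarrow> max_condition_below G (carrier G)"
  by (auto simp: max_condition_on_subgroups_def max_condition_below_def
      dest: subgroup.subset)

lemma (in group) max_condition_below_one: "max_condition_below G {\<one>}"
  unfolding max_condition_below_def
proof (intro allI impI)
  fix \<S> assume \<S>: "\<S> \<noteq> {} \<and> (\<forall>H\<in>\<S>. subgroup H G \<and> H \<subseteq> {\<one>})"
  then have "H = {\<one>}" if "H \<in> \<S>" for H
    using that subgroup.one_closed[of H G] by blast
  then show "\<exists>M\<in>\<S>. \<forall>H\<in>\<S>. M \<subseteq> H \<longrightarrow> H = M"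
    using \<S> by (metis all_not_in_conv)
qed

text \<open>A member \<open>M\<close> containing the least positive integer \<open>n\<close> found
  in any member is maximal: by division with remainder, every member above it consists of multiples
  of \<open>n\<close>.\<close>

lemma int_subgroups_have_maximal:
  fixes \<S> :: "int set set"
  assumes "\<S> \<noteq> {}"
    and zero: "\<And>I. I \<in> \<S> \<Longrightarrow> 0 \<in> I"
    and diff: "\<And>I x y. I \<in> \<S> \<Longrightarrow> x \<in> I \<Longrightarrow> y \<in> I \<Longrightarrow> x - y \<in> I"
  shows "\<exists>M\<in>\<S>. \<forall>I\<in>\<S>. M \<subseteq> I \<longrightarrow> I = M"
proof (cases "\<forall>I\<in>\<S>. I \<subseteq> {0}")
  case True
  then show ?thesis using assms by blast
next
  case False
  have mult: "k * x \<in> I" if I: "I \<in> \<S>" "x \<in> I" for I k x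
  proof (induction k rule: int_induct[where k = 0])
    case (step1 i)
    have "i * x - (0 - x) \<in> I"
      using step1 I zero diff by blast
    then show ?case by (simp add: algebra_simps)
  next
    case (step2 i)
    then show ?case using diff[OF I(1) _ I(2)] by (simp add: algebra_simps)
  qed (simp add: zero I)
  let ?P = "\<lambda>n. 0 < n \<and> (\<exists>I\<in>\<S>. int n \<in> I)"
  obtain I x where I: "I \<in> \<S>" "x \<in> I" "x \<noteq> 0"
    using False by blast
  then have "\<bar>x\<bar> \<in> I"
    using mult[of I x "sgn x"] by (simp add: abs_sgn mult.commute)
  then have "?P (nat \<bar>x\<bar>)"
    using I by auto
  define n where "n = (LEAST n. ?P n)"
  have n: "?P n" unfolding n_def by (rule LeastI) fact
  have n_le: "n \<le> k" if "?P k" for k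
    unfolding n_def using that by (rule Least_le)
  obtain M where M: "M \<in> \<S>" "int n \<in> M" using n by blast
  have "I = M" if I: "I \<in> \<S>" "M \<subseteq> I" for I
  proof (intro equalityI I subsetI)
    fix x assume x: "x \<in> I"
    have "x mod int n = x - (x div int n) * int n"
      by (simp add: minus_div_mult_eq_mod)
    also have "\<dots> \<in> I" using I M x mult diff by blast
    finally have "x mod int n \<in> I" .
    moreover have "0 \<le> x mod int n" "x mod int n < int n"
      using n by simp_all
    ultimately have "x mod int n = 0"
      using n_le[of "nat (x mod int n)"] I by fastforce
    then have "x = (x div int n) * int n"
      by (metis add.right_neutral div_mult_mod_eq)
    then show "x \<in> M" using mult M by metis
  qed
  then show ?thesis using M by blast
qed

text \<open>First choose a maximal image under \<open>f\<close>, then, among the subgroups with that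
  image, a maximal intersection with the kernel. A larger subgroup then has the same image and the
  same kernel part, so it is equal.\<close>

lemma (in group) max_condition_below_kernel:
  fixes f :: "'a \<Rightarrow> int"
  assumes f_mult: "\<And>x y. x \<in> K \<Longrightarrow> y \<in> K \<Longrightarrow> f (x \<otimes> y) = f x + f y"
    and ker: "max_condition_below G {x \<in> K. f x = 0}"
  shows "max_condition_below G K"
  unfolding max_condition_below_def
proof (intro allI impI)
  fix \<S> assume \<S>: "\<S> \<noteq> {} \<and> (\<forall>H\<in>\<S>. subgroup H G \<and> H \<subseteq> K)"
  then have sub: "subgroup H G" and f_mult_H: "\<And>x y. x \<in> H \<Longrightarrow> y \<in> H \<Longrightarrow> f (x \<otimes> y) = f x + f y"
    if "H \<in> \<S>" for H
    using that f_mult by blast+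
  have f_one: "f \<one> = 0" if "H \<in> \<S>" for H
    using f_mult_H[OF that, of \<one> \<one>] subgroup.one_closed[OF sub[OF that]] by simp
  have f_diff: "f (x \<otimes> inv y) = f x - f y" "x \<otimes> inv y \<in> H"
    if H: "H \<in> \<S>" "x \<in> H" "y \<in> H" for H x y
  proof -
    have inv: "inv y \<in> H" "y \<in> carrier G"
      using H sub subgroup.m_inv_closed subgroup.mem_carrier by metis+
    show "f (x \<otimes> inv y) = f x - f y"
      using f_mult_H[OF H(1) H(3) inv(1)] f_mult_H[OF H(1) H(2) inv(1)] f_one[OF H(1)] inv(2)
      by simp
    show "x \<otimes> inv y \<in> H"
      using inv H sub subgroup.m_closed by metis
  qed
  have "\<exists>M\<in>(`) f ` \<S>. \<forall>I\<in>(`) f ` \<S>. M \<subseteq> I \<longrightarrow> I = M"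
  proof (rule int_subgroups_have_maximal)
    show "(`) f ` \<S> \<noteq> {}" using \<S> by simp
    show "0 \<in> I" if "I \<in> (`) f ` \<S>" for I
      using that f_one sub subgroup.one_closed by (metis (no_types, lifting) image_iff)
    fix I x y assume "I \<in> (`) f ` \<S>" "x \<in> I" "y \<in> I"
    then obtain H g h where "H \<in> \<S>" "I = f ` H" "g \<in> H" "x = f g" "h \<in> H" "y = f h"
      by blast
    then show "x - y \<in> I"
      using f_diff[of H g h] by (metis imageI)
  qed
  then obtain H0 where H0: "H0 \<in> \<S>" "\<And>H. H \<in> \<S> \<Longrightarrow> f ` H0 \<subseteq> f ` H \<Longrightarrow> f ` H = f ` H0"
    unfolding bex_simps ball_simps by (elim bexE) simp
  define \<T> where "\<T> = {H \<in> \<S>. f ` H = f ` H0}"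
  let ?k = "\<lambda>H. {x \<in> H. f x = 0}"
  have "subgroup (?k H) G \<and> ?k H \<subseteq> {x \<in> K. f x = 0}" if "H \<in> \<S>" for H
  proof
    interpret H: subgroup H G by (rule sub) fact
    have "f (inv x) = 0" if "x \<in> H" "f x = 0" for x
      using f_diff(1)[OF \<open>H \<in> \<S>\<close> H.one_closed that(1)] that f_one[OF \<open>H \<in> \<S>\<close>] by simp
    then show "subgroup (?k H) G"
      using f_one[OF that] f_mult_H[OF that] by unfold_locales auto
  qed (use \<S> that in blast)
  then have "\<forall>L\<in>?k ` \<T>. subgroup L G \<and> L \<subseteq> {x \<in> K. f x = 0}"
    by (auto simp: \<T>_def)
  moreover have "?k ` \<T> \<noteq> {}"
    using H0(1) by (auto simp: \<T>_def)
  ultimately have "\<exists>M\<in>?k ` \<T>. \<forall>L\<in>?k ` \<T>. M \<subseteq> L \<longrightarrow> L = M"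
    using ker unfolding max_condition_below_def by meson
  then obtain M where M: "M \<in> \<T>" "\<And>H. H \<in> \<T> \<Longrightarrow> ?k M \<subseteq> ?k H \<Longrightarrow> ?k H = ?k M"
    unfolding bex_simps ball_simps by (elim bexE) simp
  have M\<S>: "M \<in> \<S>" "f ` M = f ` H0" using M by (auto simp: \<T>_def)
  have "H = M" if H: "H \<in> \<S>" "M \<subseteq> H" for H
  proof (intro equalityI H subsetI)
    fix x assume x: "x \<in> H"
    have im: "f ` H = f ` M"
      using H0(2)[OF H(1)] M\<S> image_mono[OF H(2), of f] by simp
    then have "H \<in> \<T>" using H M\<S> by (simp add: \<T>_def)
    then have k: "?k H = ?k M" using M(2) H(2) by blast
    \<comment> \<open>Divide \<open>x\<close> by an element of \<open>M\<close> with the same value: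
      the quotient lies in the common kernel part.\<close>
    obtain y where y: "y \<in> M" "f y = f x" using im x by (metis imageE imageI)
    have "x \<otimes> inv y \<in> ?k H"
      using f_diff[OF H(1) x, of y] y H(2) by auto
    then have "x \<otimes> inv y \<in> M" using k by blast
    then have "x \<otimes> inv y \<otimes> y \<in> M"
      using y(1) subgroup.m_closed[OF sub[OF M\<S>(1)]] by blast
    moreover have "x \<in> carrier G" "y \<in> carrier G"
      using x y subgroup.mem_carrier[OF sub] H M\<S> by blast+
    ultimately show "x \<in> M" by (simp add: m_assoc)
  qed
  then show "\<exists>M\<in>\<S>. \<forall>H\<in>\<S>. M \<subseteq> H \<longrightarrow> H = M"
    using M\<S>(1) by blast
qed

section \<open>The group\<close>

text \<open>The pair (a + b sqrt 2, k) is stored as the list of its three integers, to fit the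
  carrier type \<open>int list\<close>.\<close>

definition enc :: "zsqrt2 \<Rightarrow> int \<Rightarrow> int list" where
  "enc z k = [ipart z, rpart z, k]"

definition base :: "int list \<Rightarrow> zsqrt2" where
  "base g = ZSqrt2 (g ! 0) (g ! 1)"

definition height :: "int list \<Rightarrow> int" where
  "height g = g ! 2"

lemma enc_inject [simp]: "enc y k = enc z l \<longleftrightarrow> y = z \<and> k = l"
  by (auto simp: enc_def zsqrt2_eq_iff)

lemma base_enc [simp]: "base (enc z k) = z"
  and height_enc [simp]: "height (enc z k) = k"
  by (simp_all add: enc_def base_def height_def)

definition sdprod :: "int list monoid" where
  "sdprod = \<lparr>carrier = {enc z k |z k. True},
     monoid.mult = (\<lambda>g h. enc (base g + act (height g) * base h) (height g + height h)),
     one = enc 0 0\<rparr>"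

lemma enc_closed [simp]: "enc z k \<in> carrier sdprod"
  by (auto simp: sdprod_def)

lemma sdprod_cases:
  assumes "g \<in> carrier sdprod"
  obtains z k where "g = enc z k"
  using assms by (auto simp: sdprod_def)

lemma one_sdprod: "\<one>\<^bsub>sdprod\<^esub> = enc 0 0"
  by (simp add: sdprod_def)

lemma mult_sdprod [simp]:
  "enc y k \<otimes>\<^bsub>sdprod\<^esub> enc z l = enc (y + act k * z) (k + l)"
  by (simp add: sdprod_def)

interpretation sdprod: group sdprod
proof (rule groupI)
  fix g h i assume "g \<in> carrier sdprod" "h \<in> carrier sdprod" "i \<in> carrier sdprod"
  then show "g \<otimes>\<^bsub>sdprod\<^esub> h \<otimes>\<^bsub>sdprod\<^esub> i = g \<otimes>\<^bsub>sdprod\<^esub> (h \<otimes>\<^bsub>sdprod\<^esub> i)"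
    by (elim sdprod_cases) (simp add: act_add algebra_simps)
next
  fix g assume "g \<in> carrier sdprod"
  then obtain z k where "g = enc z k" by (rule sdprod_cases)
  then have "enc (- (act (- k) * z)) (- k) \<otimes>\<^bsub>sdprod\<^esub> g = \<one>\<^bsub>sdprod\<^esub>"
    by (simp add: one_sdprod)
  then show "\<exists>h\<in>carrier sdprod. h \<otimes>\<^bsub>sdprod\<^esub> g = \<one>\<^bsub>sdprod\<^esub>"
    using enc_closed by blast
qed (auto elim!: sdprod_cases simp: one_sdprod)

lemma inv_sdprod [simp]: "inv\<^bsub>sdprod\<^esub> (enc z k) = enc (- (act (- k) * z)) (- k)"
  by (rule sdprod.inv_equality) (simp_all add: one_sdprod)

lemma act_mult_act_minus_mult [simp]: "act k * (act (- k) * z) = z"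
  by (simp add: mult.assoc[symmetric])

section \<open>Congruence subgroups and structure of the group\<close>

text \<open>For \<open>m = 0\<close> the condition forces \<open>k = 0\<close>, which gives the copy
  of dR inside the base R.\<close>

definition congruence_subgroup :: "int \<Rightarrow> zsqrt2 \<Rightarrow> int list set" where
  "congruence_subgroup m d = {enc z k |z k. m dvd k \<and> d dvd z}"

lemma enc_mem_congruence_subgroup_iff [simp]:
  "enc z k \<in> congruence_subgroup m d \<longleftrightarrow> m dvd k \<and> d dvd z"
  by (auto simp: congruence_subgroup_def)

text \<open>Conjugating \<open>enc z k\<close> by \<open>enc y l\<close> gives base part
  \<open>act l * z - (act k - 1) * y\<close>, and \<open>d\<close> divides \<open>act k - 1\<close>
  because \<open>m\<close> divides \<open>k\<close>.\<close>

lemma congruence_subgroup_normal: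
  assumes "d dvd act m - 1"
  shows "congruence_subgroup m d \<lhd> sdprod"
  unfolding sdprod.normal_inv_iff
proof (intro conjI ballI)
  show "subgroup (congruence_subgroup m d) sdprod"
  proof (rule sdprod.subgroupI)
    show "congruence_subgroup m d \<noteq> {}"
      using enc_mem_congruence_subgroup_iff[of 0 0 m d] by force
  qed (auto simp: congruence_subgroup_def)
  fix x h assume "x \<in> carrier sdprod" "h \<in> congruence_subgroup m d"
  then obtain y l z k where x: "x = enc y l" and h: "h = enc z k" "m dvd k" "d dvd z"
    by (auto simp: congruence_subgroup_def elim: sdprod_cases)
  have "d dvd act k - 1"
    using dvd_act_minus_1_mult[OF assms] h(2) by (metis dvdE mult.commute)
  then have "d dvd act l * z - (act k - 1) * y"
    by (rule dvd_diff[OF dvd_mult[OF h(3)] dvd_mult2])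
  moreover have "act (l + k) * (act (- l) * y) = act k * y"
    by (simp add: act_add mult.commute[of "act l" "act k"] mult.assoc)
  then have "x \<otimes>\<^bsub>sdprod\<^esub> h \<otimes>\<^bsub>sdprod\<^esub> inv\<^bsub>sdprod\<^esub> x = enc (act l * z - (act k - 1) * y) k"
    by (simp add: x h left_diff_distrib)
  ultimately show "x \<otimes>\<^bsub>sdprod\<^esub> h \<otimes>\<^bsub>sdprod\<^esub> inv\<^bsub>sdprod\<^esub> x \<in> congruence_subgroup m d"
    using h(2) by simp
qed

lemma commutator_sdprod:
  assumes "x \<in> carrier sdprod" "y \<in> carrier sdprod"
  obtains z where "x \<otimes>\<^bsub>sdprod\<^esub> y \<otimes>\<^bsub>sdprod\<^esub> inv\<^bsub>sdprod\<^esub> x \<otimes>\<^bsub>sdprod\<^esub> inv\<^bsub>sdprod\<^esub> y = enc z 0"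
  using assms by (elim sdprod_cases) simp

text \<open>Commutators have height 0, so the derived subgroup lies in the copy of the additive
  group of R.\<close>

lemma metabelian_sdprod: "metabelian_group sdprod"
proof -
  let ?D = "derived sdprod (carrier sdprod)"
  have "congruence_subgroup 0 1 \<lhd> sdprod"
    by (rule congruence_subgroup_normal) simp
  then have "subgroup (congruence_subgroup 0 1) sdprod"
    by (simp add: sdprod.normal_inv_iff)
  then have "?D \<subseteq> congruence_subgroup 0 1"
    unfolding derived_def
    by (intro sdprod.generate_subgroup_incl) (auto elim!: sdprod_cases)
  then have D: "\<exists>z. g = enc z 0" if "g \<in> ?D" for g
    using that by (auto simp: congruence_subgroup_def)
  have "subgroup ?D sdprod"
    by (rule sdprod.derived_is_subgroup) simp
  then have "group (sdprod\<lparr>carrier := ?D\<rparr>)"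
    by (rule sdprod.subgroup_imp_group)
  then have "comm_group (sdprod\<lparr>carrier := ?D\<rparr>)"
    by (rule group.group_comm_groupI) (auto dest!: D simp: add.commute)
  then show ?thesis
    by (simp add: metabelian_group_def sdprod.is_group)
qed

text \<open>Three successive kernels lead to the trivial group: \<open>height\<close>, then the two
  coordinates, which are additive at height 0 because the action is trivial there.\<close>

lemma max_condition_sdprod: "max_condition_on_subgroups sdprod"
  unfolding max_condition_on_subgroups_iff
proof (rule sdprod.max_condition_below_kernel[where f = height])
  show "max_condition_below sdprod {g \<in> carrier sdprod. height g = 0}"
  proof (rule sdprod.max_condition_below_kernel[where f = "\<lambda>g. ipart (base g)"])
    show "max_condition_below sdprod
        {g \<in> {g \<in> carrier sdprod. height g = 0}. ipart (base g) = 0}"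
    proof (rule sdprod.max_condition_below_kernel[where f = "\<lambda>g. rpart (base g)"])
      have triv: "{g \<in> {g \<in> {g \<in> carrier sdprod. height g = 0}. ipart (base g) = 0}.
          rpart (base g) = 0} = {\<one>\<^bsub>sdprod\<^esub>}"
        by (auto elim!: sdprod_cases simp: one_sdprod zsqrt2_eq_iff)
      show "max_condition_below sdprod
          {g \<in> {g \<in> {g \<in> carrier sdprod. height g = 0}. ipart (base g) = 0}. rpart (base g) = 0}"
        unfolding triv by (rule sdprod.max_condition_below_one)
    qed (auto elim!: sdprod_cases)
  qed (auto elim!: sdprod_cases)
qed (auto elim!: sdprod_cases)

lemma ex_two_power_greater: "\<exists>n. b < (2::int) ^ n"
proof
  show "b < 2 ^ nat b"
    using of_nat_less_two_power[of "nat b", where 'a = int] by linarith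
qed

section \<open>The pseudocentre is trivial\<close>

lemma pseudocentre_sdprod: "pseudocentre sdprod = {\<one>\<^bsub>sdprod\<^esub>}"
proof (intro equalityI subsetI)
  fix g assume g: "g \<in> pseudocentre sdprod"
  have g_mem: "g \<in> congruence_subgroup (2 ^ Suc n) (2 ^ n)" for n
  proof -
    have "centralizer sdprod (enc (2 ^ n) (2 ^ Suc n)) \<subseteq> congruence_subgroup (2 ^ Suc n) (2 ^ n)"
    proof
      fix h assume h: "h \<in> centralizer sdprod (enc (2 ^ n) (2 ^ Suc n))"
      then obtain y m where [simp]: "h = enc y m"
        by (auto simp: centralizer_def elim: sdprod_cases)
      \<comment> \<open>Comparison of the base parts of the two products.\<close>
      have "y * (act (2 ^ Suc n) - 1) = 2 ^ n * (act m - 1)"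
        using h by (simp add: centralizer_def algebra_simps)
      then show "h \<in> congruence_subgroup (2 ^ Suc n) (2 ^ n)"
        using centralizer_equation by simp
    qed
    moreover have "2 ^ n dvd act (2 ^ Suc n) - 1"
      using act_two_power_minus_1_dvd[of "Suc n"] by (metis dvd_mult_right power_Suc)
    ultimately show ?thesis
      using g congruence_subgroup_normal enc_closed unfolding mem_pseudocentre_iff by blast
  qed
  from g_mem[of 0] obtain z k where [simp]: "g = enc z k"
    by (auto simp: congruence_subgroup_def)
  have "of_int (2 ^ n) dvd z" "2 ^ n dvd k" for n
    using g_mem[of n] dvd_mult_right by auto
  \<comment> \<open>The height is embedded in R so that the same divisibility argument applies to
    it.\<close>
  then have "z = 0" "of_int k = (0 :: zsqrt2)"
    using ex_two_power_greater
    by (blast intro!: zsqrt2_eq_0_if_dvd_large, intro zsqrt2_eq_0_if_dvd_large)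
      (metis of_int_dvd_zsqrt2_iff zsqrt2_of_int_parts dvd_0_right)
  then show "g \<in> {\<one>\<^bsub>sdprod\<^esub>}"
    by (simp add: one_sdprod zsqrt2_eq_iff)
qed (simp add: sdprod.one_mem_pseudocentre)

section \<open>Pseudonilpotent quotients\<close>

lemma pseudonilpotent_prime_quotient:
  fixes q :: int
  assumes q: "Factorial_Ring.prime q" "odd q"
  defines "N \<equiv> congruence_subgroup 0 (of_int q)"
  shows "N \<lhd> sdprod" "pseudonilpotent_class_le_2 (sdprod Mod N)"
proof -
  show "N \<lhd> sdprod"
    unfolding N_def by (rule congruence_subgroup_normal) simp
  then interpret N: normal N sdprod .
  define Q where "Q = sdprod Mod N"
  interpret Q: group Q
    unfolding Q_def by (rule N.factorgroup_is_group)
  define \<pi> where "\<pi> = (\<lambda>g. N #>\<^bsub>sdprod\<^esub> g)"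
  interpret \<pi>: group_hom sdprod Q \<pi>
    by unfold_locales (simp add: \<pi>_def Q_def N.r_coset_hom_Mod)
  have surj: "\<exists>g\<in>carrier sdprod. S = \<pi> g" if "S \<in> carrier Q" for S
    using that by (auto simp: Q_def \<pi>_def FactGroup_def RCOSETS_def)
  have \<pi>_eq: "\<pi> (enc y k) = \<pi> (enc z k)" if "of_int q dvd y - z" for y z k
  proof -
    have "enc y k \<otimes>\<^bsub>sdprod\<^esub> inv\<^bsub>sdprod\<^esub> (enc z k) \<in> N"
      using that by (simp add: N_def)
    then have "enc y k \<in> N #>\<^bsub>sdprod\<^esub> enc z k"
      by (intro N.rcos_module_rev) (simp_all add: sdprod.is_group)
    then show ?thesis
      unfolding \<pi>_def by (intro sdprod.repr_independence[symmetric] N.is_subgroup) auto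
  qed
  have base: "\<pi> (enc z 0) \<in> pseudocentre Q" for z
    unfolding mem_pseudocentre_iff
  proof (intro ballI allI impI)
    fix S M assume S: "S \<in> carrier Q" and M: "M \<lhd> Q" and C: "centralizer Q S \<subseteq> M"
    interpret M: normal M Q by fact
    from surj[OF S] obtain y k where S_eq: "S = \<pi> (enc y k)"
      by (auto elim: sdprod_cases)
    show "\<pi> (enc z 0) \<in> M"
    proof (rule act_minus_1_prime_cases[OF q, of k])
      \<comment> \<open>Here \<open>S\<close> acts trivially on R / qR, so \<open>enc z 0\<close>
        maps into its centralizer.\<close>
      assume 1: "of_int q dvd act k - 1"
      have "\<pi> (enc z 0 \<otimes>\<^bsub>sdprod\<^esub> enc y k) = \<pi> (enc y k \<otimes>\<^bsub>sdprod\<^esub> enc z 0)"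
      proof -
        have "of_int q dvd (- z) * (act k - 1)" using 1 by (rule dvd_mult)
        then show ?thesis by (auto intro!: \<pi>_eq simp: algebra_simps)
      qed
      then have "\<pi> (enc z 0) \<in> centralizer Q S"
        by (simp add: centralizer_def S_eq del: mult_sdprod)
      then show ?thesis using C by blast
    next
      fix c assume 2: "of_int q dvd c * (act k - 1) - 1"
      \<comment> \<open>\<open>S\<close> lies in its own centralizer, so \<open>M\<close> contains
        its commutator with \<open>V\<close>; the choice of \<open>c\<close> makes that commutator
        the image of \<open>enc z 0\<close>.\<close>
      define V where "V = \<pi> (enc (- (c * z)) 0)"
      have V: "V \<in> carrier Q" by (simp add: V_def)
      have "S \<in> M" using S C by (auto simp: centralizer_def)
      then have "V \<otimes>\<^bsub>Q\<^esub> S \<otimes>\<^bsub>Q\<^esub> inv\<^bsub>Q\<^esub> V \<otimes>\<^bsub>Q\<^esub> inv\<^bsub>Q\<^esub> S \<in> M"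
        using V by (intro M.m_closed M.inv_op_closed2 M.m_inv_closed)
      also have "V \<otimes>\<^bsub>Q\<^esub> S \<otimes>\<^bsub>Q\<^esub> inv\<^bsub>Q\<^esub> V \<otimes>\<^bsub>Q\<^esub> inv\<^bsub>Q\<^esub> S =
          \<pi> (enc (- (c * z)) 0 \<otimes>\<^bsub>sdprod\<^esub> enc y k \<otimes>\<^bsub>sdprod\<^esub> inv\<^bsub>sdprod\<^esub> (enc (- (c * z)) 0)
             \<otimes>\<^bsub>sdprod\<^esub> inv\<^bsub>sdprod\<^esub> (enc y k))"
        by (simp add: V_def S_eq del: mult_sdprod inv_sdprod)
      also have "\<dots> = \<pi> (enc (c * (act k - 1) * z) 0)"
        by (simp add: algebra_simps)
      also have "\<dots> = \<pi> (enc z 0)"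
      proof (rule \<pi>_eq)
        have "of_int q dvd (c * (act k - 1) - 1) * z" using 2 by (rule dvd_mult2)
        then show "of_int q dvd c * (act k - 1) * z - z" by (simp add: algebra_simps)
      qed
      finally show ?thesis .
    qed
  qed
  have "pseudonilpotent_class_le_2 Q"
  proof (rule Q.pseudonilpotent_class_le_2_if_commutators)
    fix S T assume "S \<in> carrier Q" "T \<in> carrier Q"
    then obtain x y where xy: "x \<in> carrier sdprod" "S = \<pi> x" "y \<in> carrier sdprod" "T = \<pi> y"
      using surj by meson
    obtain z where
      "x \<otimes>\<^bsub>sdprod\<^esub> y \<otimes>\<^bsub>sdprod\<^esub> inv\<^bsub>sdprod\<^esub> x \<otimes>\<^bsub>sdprod\<^esub> inv\<^bsub>sdprod\<^esub> y = enc z 0"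
      using xy commutator_sdprod by blast
    then have "S \<otimes>\<^bsub>Q\<^esub> T \<otimes>\<^bsub>Q\<^esub> inv\<^bsub>Q\<^esub> S \<otimes>\<^bsub>Q\<^esub> inv\<^bsub>Q\<^esub> T = \<pi> (enc z 0)"
      using xy by (metis \<pi>.hom_inv \<pi>.hom_mult sdprod.inv_closed sdprod.m_closed)
    then show "S \<otimes>\<^bsub>Q\<^esub> T \<otimes>\<^bsub>Q\<^esub> inv\<^bsub>Q\<^esub> S \<otimes>\<^bsub>Q\<^esub> inv\<^bsub>Q\<^esub> T \<in> pseudocentre Q"
      using base by simp
  qed
  then show "pseudonilpotent_class_le_2 (sdprod Mod N)"
    by (simp add: Q_def)
qed

lemma residually_pseudonilpotent_sdprod: "residually_pseudonilpotent_class_le_2 sdprod"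
proof -
  let ?\<N> = "{N. N \<lhd> sdprod \<and> pseudonilpotent_class_le_2 (sdprod Mod N)}"
  have "g = \<one>\<^bsub>sdprod\<^esub>" if g: "g \<in> \<Inter>?\<N>" for g
  proof -
    have g_mem: "g \<in> congruence_subgroup 0 (of_int q)"
      if "Factorial_Ring.prime q" "odd q" for q :: int
      using pseudonilpotent_prime_quotient[OF that] by (intro InterD[OF g]) simp
    have large: "\<exists>q>b. Factorial_Ring.prime q \<and> odd q" for b :: int
    proof -
      obtain p where "Factorial_Ring.prime p" "p > max 2 (nat b)"
        using bigger_prime by blast
      moreover from this have "odd p" "b < int p"
        using prime_odd_nat[of p] by auto
      ultimately show ?thesis
        by (intro exI[of _ "int p"]) simp
    qed
    \<comment> \<open>A single odd prime already forces height 0; the base part is then divisible by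
      arbitrarily large primes.\<close>
    obtain q0 :: int where "Factorial_Ring.prime q0" "odd q0" using large[of 0] by blast
    then obtain z where [simp]: "g = enc z 0"
      using g_mem by (auto simp: congruence_subgroup_def)
    have "z = 0"
    proof (rule zsqrt2_eq_0_if_dvd_large)
      fix b :: int
      obtain q where "q > b" "Factorial_Ring.prime q" "odd q"
        using large[of b] by blast
      then show "\<exists>c>b. of_int c dvd z"
        using g_mem[of q] by auto
    qed
    then show ?thesis
      by (simp add: one_sdprod)
  qed
  moreover have "\<one>\<^bsub>sdprod\<^esub> \<in> \<Inter>?\<N>"
    by (simp add: normal_imp_subgroup subgroup.one_closed)
  ultimately have "\<Inter>?\<N> = {\<one>\<^bsub>sdprod\<^esub>}"
    by blast
  then show ?thesis
    by (simp add: residually_pseudonilpotent_class_le_2_def sdprod.is_group)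
qed

(* HOL cannot quantify existentially over types, so a carrier type has to be fixed.  Every
   polycyclic group is countable, hence isomorphic to a group on a set of integer lists.  The
   trivial group satisfies everything but the nontriviality clause. *)
theorem mainTheorem5:
  "\<exists>G :: int list monoid.
     polycyclic_group G \<and> metabelian_group G \<and> carrier G \<noteq> {\<one>\<^bsub>G\<^esub>} \<and>
     pseudocentre G = {\<one>\<^bsub>G\<^esub>} \<and>
     residually_pseudonilpotent_class_le_2 G"
proof (intro exI conjI)
  show "polycyclic_group sdprod"
    unfolding polycyclic_group_def
    by (intro conjI sdprod.is_group sdprod.metabelian_imp_solvable metabelian_sdprod
        max_condition_sdprod)
  show "carrier sdprod \<noteq> {\<one>\<^bsub>sdprod\<^esub>}"
  proof
    assume "carrier sdprod = {\<one>\<^bsub>sdprod\<^esub>}"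
    then have "enc 0 1 = enc 0 0"
      using enc_closed[of 0 1] by (simp only: one_sdprod singleton_iff)
    then show False by simp
  qed
qed (rule metabelian_sdprod pseudocentre_sdprod residually_pseudonilpotent_sdprod)+

end
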